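(* Suppose $T^3$ acts freely on $(S^3)^3$ by $$(z_1,z_2,z_3)\ast\big((a_1,a_2),(b_1,b_2),(c_1,c_2)\big)=\big((z_1a_1,\,z_1z_2^{k_2}z_3^{k_3}a_2),\,(z_2b_1,\,z_1^{l_1}z_2z_3^{l_3}b_2),\,(z_3c_1,\,z_1^{m_1}z_2^{m_2}z_3c_2)\big),$$ with integer exponents and with characteristic matrix $$A=\begin{bmatrix} 1 & k_2 & k_3 \\ l_1 & 1 & l_3 \\ m_1 & m_2 & 1 \end{bmatrix},$$ which has determinant $\pm1$ and whose three diagonal $2\times2$ cofactors each have determinant $\pm1$. Then, up to equivalence, $A$ belongs to one of the three infinite families (with arbitrary integer parameters) $$R(m_1,m_2)=\begin{bmatrix} 1 & 2 & 0 \\ 1 & 1 & 0 \\ m_1 & m_2 & 1 \end{bmatrix},\quad S(k_3,l_3)=\begin{bmatrix} 1 & 2 & k_3 \\ 1 & 1 & l_3 \\ 0 & 0 & 1 \end{bmatrix},\quad T(l_1,m_1,m_2)=\begin{bmatrix} 1 & 0 & 0 \\ l_1 & 1 & 0 \\ m_1 & m_2 & 1 \end{bmatrix},$$ or $A$ is one of the four sporadic examples $$A_1=\begin{bmatrix} 1 & 2 & 2 \\ 1 & 1 & 2 \\ 1 & 1 & 1 \end{bmatrix},\quad A_2=\begin{bmatrix} 1 & 2 & 0 \\ 1 & 1 & 2 \\ 1 & 1 & 1 \end{bmatrix},\quad A_3=\begin{bmatrix} 1 & 2 & 0 \\ 1 & 1 & 1 \\ 2 & 2 & 1 \end{bmatrix},\quad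 A_4=\begin{bmatrix} 1 & 2 & 2 \\ 1 & 1 & 2 \\ 1 & 0 & 1 \end{bmatrix}.$$
   Context: $S^3=\{(x_1,x_2)\in\mathbb{C}^2:|x_1|^2+|x_2|^2=1\}$ and $T^3$ is the torus of triples of unit complex numbers. Every matrix $A$ as in the statement defines a linear action of $T^3$ on $(S^3)^3$ by the displayed formula. Equivalence: two matrices are equivalent if the corresponding actions can be carried to each other by a sequence of the following modifications: precomposing the action with an automorphism of $T^3$; permuting the three $S^3$ factors; interchanging the two complex coordinates within an $S^3$ factor; complex conjugating one or both complex coordinates of an $S^3$ factor. (Under $S^3\cong SU(2)$ these are modifications of the defining homomorphism $f:T^3\to SU(2)^3\times SU(2)^3$ of the biquotient action by automorphisms of $T^3$, conjugation in $SU(2)^3\times SU(2)^3$, automorphisms of $SU(2)^3$ applied to both sides, and interchange of the left and right sides via inversion.) *)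

theory Defs
  imports "HOL-Analysis.Analysis"
begin

text \<open>
  A point of the ambient space of \<open>(S\<^sup>3)\<^sup>3\<close> is \<open>x :: complex^2^3\<close>, where \<open>x $ i $ j\<close> is the
  \<open>j\<close>-th complex coordinate in the \<open>i\<close>-th factor. Torus elements \<open>z :: complex^3\<close> multiply
  componentwise, and \<open>1 :: complex^3\<close> is the triple with all entries 1.
\<close>

definition S3_cubed :: "(complex^2^3) set" where
  "S3_cubed = {x. \<forall>i. (cmod (x $ i $ 1))\<^sup>2 + (cmod (x $ i $ 2))\<^sup>2 = 1}"

definition torus3 :: "(complex^3) set" where
  "torus3 = {z. \<forall>i. cmod (z $ i) = 1}"

type_synonym torus_action = "complex^3 \<Rightarrow> complex^2^3 \<Rightarrow> complex^2^3"

definition acts_freely :: "torus_action \<Rightarrow> bool" where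
  "acts_freely F \<longleftrightarrow> (\<forall>z\<in>torus3. \<forall>x\<in>S3_cubed. F z x = x \<longrightarrow> z = 1)"

text \<open>
  Row \<open>i\<close> of \<open>A\<close> lists the exponents of the character acting on the second coordinate of factor \<open>i\<close>;
  the first coordinate of factor \<open>i\<close> always has weight \<open>z\<^sub>i\<close>.
\<close>

definition lin_action :: "int^3^3 \<Rightarrow> torus_action" where
  "lin_action A z x =
     (\<chi> i. vector [z $ i * x $ i $ 1, (\<Prod>j\<in>UNIV. z $ j powi A $ i $ j) * x $ i $ 2])"

definition char_matrix :: "int \<Rightarrow> int \<Rightarrow> int \<Rightarrow> int \<Rightarrow> int \<Rightarrow> int \<Rightarrow> int^3^3" where
  "char_matrix k2 k3 l1 l3 m1 m2 =
     vector [vector [ 1, k2, k3],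
             vector [l1,  1, l3],
             vector [m1, m2,  1]]"

lemma lin_action_char_matrix:
  "lin_action (char_matrix k2 k3 l1 l3 m1 m2) z
     (vector [vector [a1, a2], vector [b1, b2], vector [c1, c2]]) =
   vector [vector [z$1 * a1, z$1 * z$2 powi k2 * z$3 powi k3 * a2],
           vector [z$2 * b1, z$1 powi l1 * z$2 * z$3 powi l3 * b2],
           vector [z$3 * c1, z$1 powi m1 * z$2 powi m2 * z$3 * c2]]"
proof -
  have prod_3: "(\<Prod>j\<in>UNIV. f j) = f 1 * f 2 * f 3" for f :: "3 \<Rightarrow> complex"
    unfolding UNIV_3 by (simp add: mult.assoc)
  have vector_eqI: "v = vector [v $ 1, v $ 2, v $ 3]" for v :: "complex^2^3"
    by (simp add: vec_eq_iff [of v] forall_3)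
  show ?thesis
    by (subst vector_eqI) (simp add: lin_action_def char_matrix_def prod_3)
qed

text \<open>Automorphisms of the torus are understood as those of a Lie group, i.e. bicontinuous.\<close>

definition torus_automorphism :: "(complex^3 \<Rightarrow> complex^3) \<Rightarrow> bool" where
  "torus_automorphism \<phi> \<longleftrightarrow>
     (\<exists>\<psi>. homeomorphism torus3 torus3 \<phi> \<psi>) \<and>
     (\<forall>z\<in>torus3. \<forall>w\<in>torus3. \<phi> (z * w) = \<phi> z * \<phi> w)"

definition permute_factors :: "(3 \<Rightarrow> 3) \<Rightarrow> complex^2^3 \<Rightarrow> complex^2^3" where
  "permute_factors \<sigma> x = (\<chi> i. x $ \<sigma> i)"

definition swap_coords :: "3 \<Rightarrow> complex^2^3 \<Rightarrow> complex^2^3" where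
  "swap_coords k x = (\<chi> i. if i = k then vector [x $ i $ 2, x $ i $ 1] else x $ i)"

definition conj_coord :: "3 \<Rightarrow> 2 \<Rightarrow> complex^2^3 \<Rightarrow> complex^2^3" where
  "conj_coord k l x = (\<chi> i j. if i = k \<and> j = l then cnj (x $ i $ j) else x $ i $ j)"

text \<open>Conjugating both coordinates of a factor is two successive uses of \<^const>\<open>conj_coord\<close>.\<close>

inductive space_modification :: "(complex^2^3 \<Rightarrow> complex^2^3) \<Rightarrow> bool" where
  permute: "bij \<sigma> \<Longrightarrow> space_modification (permute_factors \<sigma>)"
| swap: "space_modification (swap_coords k)"
| conj: "space_modification (conj_coord k l)"

text \<open>
  \<open>modification F G\<close>: one modification carries the action \<open>F\<close> to the action \<open>G\<close>. Actions are
  compared only for arguments in \<^const>\<open>torus3\<close> and \<^const>\<open>S3_cubed\<close>; their values elsewhere are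
  irrelevant. A change of coordinates \<open>h\<close> turns \<open>F\<close> into \<open>h \<circ> F z \<circ> h\<^sup>-\<^sup>1\<close>.
\<close>

inductive modification :: "torus_action \<Rightarrow> torus_action \<Rightarrow> bool" where
  reparametrize:
    "torus_automorphism \<phi> \<Longrightarrow>
     (\<And>z x. z \<in> torus3 \<Longrightarrow> x \<in> S3_cubed \<Longrightarrow> G z x = F (\<phi> z) x) \<Longrightarrow>
     modification F G"
| change_coords:
    "space_modification h \<Longrightarrow>
     (\<And>z x. z \<in> torus3 \<Longrightarrow> x \<in> S3_cubed \<Longrightarrow> G z (h x) = h (F z x)) \<Longrightarrow>
     modification F G"

definition equivalent_matrices :: "int^3^3 \<Rightarrow> int^3^3 \<Rightarrow> bool" where
  "equivalent_matrices A B \<longleftrightarrow> modification\<^sup>*\<^sup>* (lin_action A) (lin_action B)"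

definition family_R :: "int \<Rightarrow> int \<Rightarrow> int^3^3" where
  "family_R m1 m2 = vector [vector [1, 2, 0], vector [1, 1, 0], vector [m1, m2, 1]]"

definition family_S :: "int \<Rightarrow> int \<Rightarrow> int^3^3" where
  "family_S k3 l3 = vector [vector [1, 2, k3], vector [1, 1, l3], vector [0, 0, 1]]"

definition family_T :: "int \<Rightarrow> int \<Rightarrow> int \<Rightarrow> int^3^3" where
  "family_T l1 m1 m2 = vector [vector [1, 0, 0], vector [l1, 1, 0], vector [m1, m2, 1]]"

definition sporadic_1 :: "int^3^3" where
  "sporadic_1 = vector [vector [1, 2, 2], vector [1, 1, 2], vector [1, 1, 1]]"

definition sporadic_2 :: "int^3^3" where
  "sporadic_2 = vector [vector [1, 2, 0], vector [1, 1, 2], vector [1, 1, 1]]"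

definition sporadic_3 :: "int^3^3" where
  "sporadic_3 = vector [vector [1, 2, 0], vector [1, 1, 1], vector [2, 2, 1]]"

definition sporadic_4 :: "int^3^3" where
  "sporadic_4 = vector [vector [1, 2, 2], vector [1, 1, 2], vector [1, 0, 1]]"

end

theory Submission
  imports Defs
begin

text \<open>
  View the off-diagonal part of \<open>A\<close> as a weighted digraph on three vertices. The
  hypotheses only involve the products of the weights along directed cycles: the products
  \<open>a = k2 * l1\<close>, \<open>b = k3 * m1\<close>, \<open>c = l3 * m2\<close> along the 2-cycles and the products
  \<open>p = k2 * l3 * m1\<close>, \<open>q = k3 * l1 * m2\<close> along the two 3-cycles. The cofactors are \<open>1 - a\<close>, \<open>1 - b\<close>,
  \<open>1 - c\<close>, so that each of \<open>a\<close>, \<open>b\<close>, \<open>c\<close> is 0 or 2, and the determinant is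
  \<open>1 - (a + b + c) + (p + q)\<close>. Since moreover \<open>p * q = a * b * c\<close>, once the number of 2s among
  \<open>a\<close>, \<open>b\<close>, \<open>c\<close> is fixed, only few values of \<open>(p, q)\<close> remain.

  Three moves on matrices come from the modifications of the action. Permuting the factors permutes
  rows and columns simultaneously. Conjugating both coordinates of a factor negates the matching row
  and column. Interchanging the coordinates of a factor and changing the basis of the character
  lattice so that the new first weights become the standard ones is a pivot step, as in Gaussian
  elimination (\<open>equivalent_matrices_pivot\<close>). The first two moves preserve the multiset of cycle
  products, while the pivot can change the number of 2s:

    \<^item> No 2s. If \<open>p = q = 0\<close> the digraph is acyclic, and ordering its vertices gives family \<open>T\<close>.
      Otherwise one 3-cycle has product -2 and the other vanishes; a pivot leads to one 2.

    \<^item> One 2. If \<open>p = q = 0\<close> the matrix is in the family \<open>R\<close> or \<open>S\<close> up to permutation and sign.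
      Otherwise one 3-cycle has product 2, and a pivot leads to two 2s with a 3-cycle of product 2.

    \<^item> Two 2s. One 3-cycle vanishes and the other has product 2 or 4. For product 2, a pivot leads to
      three 2s. For product 4, four positive matrices remain up to permutation and sign; three of them
      are \<open>A\<^sub>2\<close>, \<open>A\<^sub>3\<close>, \<open>A\<^sub>4\<close>, and a pivot takes the fourth to \<open>A\<^sub>2\<close>.

    \<^item> Three 2s. Then \<open>p * q = 8\<close> forces \<open>{p, q} = {2, 4}\<close>, and the matrix is \<open>A\<^sub>1\<close> up to
      permutation and sign.
\<close>

section \<open>Linear torus actions with arbitrary weights\<close>

definition torus_char :: "int^3 \<Rightarrow> complex^3 \<Rightarrow> complex" where
  "torus_char w z = (\<Prod>j\<in>UNIV. z $ j powi w $ j)"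

text \<open>
  The modifications of a linear action do not keep the first weight of factor \<open>i\<close> equal to the \<open>i\<close>-th
  standard character. They act transparently once both weights of every factor are arbitrary:
  row \<open>i\<close> of \<open>W\<close> and of \<open>V\<close> are the weights on the first and second coordinate of factor \<open>i\<close>.
\<close>

definition weight_action :: "int^3^3 \<Rightarrow> int^3^3 \<Rightarrow> torus_action" where
  "weight_action W V z x =
     (\<chi> i. vector [torus_char (W $ i) z * x $ i $ 1, torus_char (V $ i) z * x $ i $ 2])"

text \<open>
  On the torus this is the endomorphism whose pull-back of characters is \<open>w \<mapsto> w v* M\<close>.
\<close>

definition torus_hom :: "int^3^3 \<Rightarrow> complex^3 \<Rightarrow> complex^3" where
  "torus_hom M z = (\<chi> i. torus_char (M $ i) z)"

lemma torus3_nonzero: "z \<in> torus3 \<Longrightarrow> z $ j \<noteq> 0"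
  by (auto simp: torus3_def dest: spec[of _ j])

lemma torus_char_expand:
  "torus_char w z = z $ 1 powi w $ 1 * z $ 2 powi w $ 2 * z $ 3 powi w $ 3"
  unfolding torus_char_def UNIV_3 by (simp add: mult.assoc)

lemma torus_char_axis: "torus_char (mat 1 $ i) z = z $ i"
proof -
  have "torus_char (mat 1 $ i) z = (\<Prod>j\<in>UNIV. if j = i then z $ j else 1)"
    unfolding torus_char_def by (intro prod.cong) (auto simp: mat_def)
  then show ?thesis by simp
qed

text \<open>
  Inversion and conjugation agree on the unit circle. This is why conjugating a coordinate negates
  its weight.
\<close>

lemma torus_char_uminus:
  assumes "z \<in> torus3"
  shows "torus_char (- w) z = cnj (torus_char w z)"
proof -
  have "inverse (z $ j) = cnj (z $ j)" for j
    using assms complex_norm_square[of "z $ j"] torus3_nonzero[OF assms, of j]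
    by (simp add: torus3_def field_simps)
  then show ?thesis
    by (simp add: torus_char_def power_int_minus power_int_inverse[symmetric])
qed

lemma torus_char_torus_hom:
  assumes "z \<in> torus3"
  shows "torus_char w (torus_hom M z) = torus_char (w v* M) z"
  using torus3_nonzero[OF assms]
  by (simp add: torus_char_expand torus_hom_def vector_matrix_mult_def sum_3
      power_int_add power_int_mult_distrib power_int_mult[symmetric] mult_ac)

lemma weight_action_reparametrize:
  assumes "z \<in> torus3"
  shows "weight_action W V (torus_hom M z) x = weight_action (W ** M) (V ** M) z x"
proof -
  have row: "(B ** M) $ i = B $ i v* M" for B :: "int^3^3" and i
    by (simp add: vec_eq_iff matrix_matrix_mult_def vector_matrix_mult_def mult.commute)
  show ?thesis
    by (simp add: weight_action_def torus_char_torus_hom[OF assms] row)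
qed

lemma torus_hom_torus_hom:
  assumes "z \<in> torus3" "M ** N = mat 1"
  shows "torus_hom M (torus_hom N z) = z"
proof -
  have "M $ i v* N = (M ** N) $ i" for i
    by (simp add: vec_eq_iff matrix_matrix_mult_def vector_matrix_mult_def mult.commute)
  then have "torus_hom M (torus_hom N z) $ i = z $ i" for i
    by (subst torus_hom_def) (simp add: torus_char_torus_hom[OF assms(1)] assms(2) torus_char_axis)
  then show ?thesis by (simp add: vec_eq_iff)
qed

lemma torus_hom_mem: "z \<in> torus3 \<Longrightarrow> torus_hom M z \<in> torus3"
  by (simp add: torus3_def torus_hom_def torus_char_def prod_norm[symmetric] norm_power_int)

lemma torus_hom_continuous: "continuous_on torus3 (torus_hom M)"
  unfolding torus_hom_def torus_char_def
  by (intro continuous_intros) (auto simp: torus3_nonzero)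

lemma torus_automorphism_torus_hom:
  assumes "M ** N = mat 1" "N ** M = mat 1"
  shows "torus_automorphism (torus_hom M)"
  unfolding torus_automorphism_def
proof (intro conjI exI ballI)
  show "homeomorphism torus3 torus3 (torus_hom M) (torus_hom N)"
    by (intro homeomorphismI torus_hom_continuous)
       (auto simp: torus_hom_mem torus_hom_torus_hom assms)
  show "torus_hom M (z * w) = torus_hom M z * torus_hom M w" for z w
    by (simp add: vec_eq_iff torus_hom_def torus_char_def power_int_mult_distrib prod.distrib)
qed

lemma lin_action_eq_weight_action: "lin_action A = weight_action (mat 1) A"
  by (intro ext) (simp add: lin_action_def weight_action_def torus_char_axis, simp add: torus_char_def)

section \<open>Effect of the modifications on the weights\<close>

lemma modification_reparametrize:
  assumes "M ** N = mat 1" "N ** M = mat 1"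
  shows "modification (weight_action W V) (weight_action (W ** M) (V ** M))"
  by (rule modification.reparametrize[OF torus_automorphism_torus_hom[OF assms]])
     (simp add: weight_action_reparametrize)

lemma modification_permute:
  assumes "bij \<sigma>"
  shows "modification (weight_action W V)
           (weight_action (\<chi> i. W $ \<sigma> i) (\<chi> i. V $ \<sigma> i))"
  by (rule modification.change_coords[OF space_modification.permute[OF assms]])
     (simp add: weight_action_def permute_factors_def)

lemma modification_swap:
  "modification (weight_action W V)
     (weight_action (\<chi> i. if i = k then V $ i else W $ i)
                    (\<chi> i. if i = k then W $ i else V $ i))"
  by (rule modification.change_coords[OF space_modification.swap[of k]])
     (auto simp: weight_action_def swap_coords_def vec_eq_iff)

lemma modification_conj_first:
  "modification (weight_action W V)
     (weight_action (\<chi> i. if i = k then - W $ i else W $ i) V)"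
  by (rule modification.change_coords[OF space_modification.conj[of k 1]])
     (auto simp: weight_action_def conj_coord_def vec_eq_iff forall_2 torus_char_uminus)

lemma modification_conj_second:
  "modification (weight_action W V)
     (weight_action W (\<chi> i. if i = k then - V $ i else V $ i))"
  by (rule modification.change_coords[OF space_modification.conj[of k 2]])
     (auto simp: weight_action_def conj_coord_def vec_eq_iff forall_2 torus_char_uminus)

section \<open>Moves on characteristic matrices\<close>

lemma char_matrix_eqI:
  assumes "A $ 1 $ 1 = 1" "A $ 1 $ 2 = k2" "A $ 1 $ 3 = k3"
          "A $ 2 $ 1 = l1" "A $ 2 $ 2 = 1" "A $ 2 $ 3 = l3"
          "A $ 3 $ 1 = m1" "A $ 3 $ 2 = m2" "A $ 3 $ 3 = 1"
  shows "A = char_matrix k2 k3 l1 l3 m1 m2"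
  using assms by (simp add: char_matrix_def vec_eq_iff forall_3)

lemma equivalent_matrices_permute:
  assumes "bij \<sigma>"
  shows "equivalent_matrices A (\<chi> i j. A $ \<sigma> i $ \<sigma> j)"
proof -
  \<comment> \<open>Permuting the factors turns the first weights \<open>mat 1\<close> into the permutation matrix \<open>N\<close>.
    Its inverse \<open>M\<close> restores \<open>mat 1\<close> and permutes the columns of the second weights.\<close>
  define N M :: "int^3^3"
    where "N = (\<chi> i j. if \<sigma> i = j then 1 else 0)"
      and "M = (\<chi> i j. if i = \<sigma> j then 1 else 0)"
  have [simp]: "\<sigma> i = \<sigma> j \<longleftrightarrow> i = j" for i j
    using assms by (auto dest: bij_is_inj injD)
  have row: "(\<chi> i. mat 1 $ \<sigma> i) = N"
    by (simp add: vec_eq_iff N_def mat_def)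
  have mult_M: "B ** M = (\<chi> i j. B $ i $ \<sigma> j)" for B :: "int^3^3"
    by (simp add: vec_eq_iff matrix_matrix_mult_def M_def if_distrib cong: if_cong)
  have NM: "N ** M = mat 1"
    by (simp add: mult_M) (simp add: N_def mat_def vec_eq_iff)
  have "i = \<sigma> j \<longleftrightarrow> j = inv \<sigma> i" for i j
    using assms by (auto simp: bij_is_inj bij_is_surj surj_f_inv_f)
  then have "M ** B = (\<chi> i. B $ inv \<sigma> i)" for B :: "int^3^3"
    by (simp add: vec_eq_iff matrix_matrix_mult_def M_def if_distrib[of "\<lambda>x. x * c" for c]
        cong: if_cong)
  then have MN: "M ** N = mat 1"
    using assms by (simp add: vec_eq_iff N_def mat_def bij_is_surj surj_f_inv_f)
  have "modification (lin_action A) (weight_action N (\<chi> i. A $ \<sigma> i))"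
    using modification_permute[OF assms, of "mat 1" A]
    by (simp add: lin_action_eq_weight_action row)
  moreover have "modification (weight_action N (\<chi> i. A $ \<sigma> i)) (lin_action (\<chi> i j. A $ \<sigma> i $ \<sigma> j))"
    using modification_reparametrize[OF MN NM, of N "\<chi> i. A $ \<sigma> i"]
    by (simp add: lin_action_eq_weight_action NM) (simp add: mult_M)
  ultimately show ?thesis
    unfolding equivalent_matrices_def by (meson rtranclp.rtrancl_into_rtrancl rtranclp.rtrancl_refl)
qed

lemma equivalent_matrices_negate_row_col:
  "equivalent_matrices A (\<chi> i j. if (i = k) \<noteq> (j = k) then - A $ i $ j else A $ i $ j)"
    (is "equivalent_matrices A ?B")
proof -
  \<comment> \<open>Conjugating both coordinates of factor \<open>k\<close> negates row \<open>k\<close> of both weight matrices;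
    reparametrizing by \<open>D\<close>, its own inverse, makes the first weights standard again and negates
    column \<open>k\<close> of the second ones.\<close>
  define D V :: "int^3^3"
    where "D = (\<chi> i. if i = k then - mat 1 $ i else mat 1 $ i)"
    and "V = (\<chi> i. if i = k then - A $ i else A $ i)"
  have D: "D $ i $ j = (if i = j then if j = k then -1 else 1 else 0)" for i j
    by (simp add: D_def mat_def)
  have mult_D: "B ** D = (\<chi> i j. if j = k then - B $ i $ j else B $ i $ j)" for B :: "int^3^3"
    by (simp add: vec_eq_iff matrix_matrix_mult_def D if_distrib cong: if_cong)
  have DD: "D ** D = mat 1"
    by (simp add: mult_D) (simp add: vec_eq_iff D mat_def)
  have VD: "V ** D = ?B"
    unfolding mult_D by (simp add: vec_eq_iff V_def)
  have "modification (lin_action A) (weight_action D A)"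
    unfolding lin_action_eq_weight_action D_def by (rule modification_conj_first)
  moreover have "modification (weight_action D A) (weight_action D V)"
    unfolding V_def by (rule modification_conj_second)
  moreover have "modification (weight_action D V) (lin_action ?B)"
    using modification_reparametrize[OF DD DD, of D V]
    by (simp add: lin_action_eq_weight_action DD VD)
  ultimately show ?thesis
    unfolding equivalent_matrices_def by (meson rtranclp.rtrancl_into_rtrancl rtranclp.rtrancl_refl)
qed

text \<open>
  Interchange the coordinates of the first factor. Its new first weight is
  \<open>f = e\<^sub>1 + k2 e\<^sub>2 + k3 e\<^sub>3\<close>, and the matrix is rewritten in the basis
  \<open>f, e\<^sub>2, e\<^sub>3\<close> by substituting \<open>e\<^sub>1 = f - k2 e\<^sub>2 - k3 e\<^sub>3\<close>. This turns the
  second and third diagonal entries into \<open>1 - k2 * l1\<close> and \<open>1 - k3 * m1\<close>, which are signs by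
  hypothesis; where such an entry is -1, conjugating the second coordinate of that factor negates the
  row and makes it 1 again.
\<close>

lemma equivalent_matrices_pivot:
  assumes "k2 * l1 \<in> {0, 2}" "k3 * m1 \<in> {0, 2}"
  shows "equivalent_matrices (char_matrix k2 k3 l1 l3 m1 m2)
    (char_matrix (- k2) (- k3)
       ((1 - k2 * l1) * l1) ((1 - k2 * l1) * (l3 - l1 * k3))
       ((1 - k3 * m1) * m1) ((1 - k3 * m1) * (m2 - m1 * k2)))"
    (is "equivalent_matrices ?A ?B")
proof -
  \<comment> \<open>\<open>N\<close>, \<open>V\<close> are the weights after the interchange, \<open>U\<close> is \<open>V\<close> in the new basis,
    and \<open>V2\<close> is \<open>U\<close> with its second row normalized.\<close>
  define N M V U V2 :: "int^3^3"
    where "N = vector [vector [1, k2, k3], vector [0, 1, 0], vector [0, 0, 1]]"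
      and "M = vector [vector [1, - k2, - k3], vector [0, 1, 0], vector [0, 0, 1]]"
      and "V = vector [vector [1, 0, 0], vector [l1, 1, l3], vector [m1, m2, 1]]"
      and "U = V ** M"
      and "V2 = (if k2 * l1 = 2 then \<chi> i. if i = 2 then - U $ i else U $ i else U)"
  have NM: "N ** M = mat 1" and MN: "M ** N = mat 1"
    by (simp_all add: N_def M_def vec_eq_iff matrix_matrix_mult_def sum_3 forall_3 mat_def)
  have U: "U = vector [vector [1, - k2, - k3], vector [l1, 1 - l1 * k2, l3 - l1 * k3],
                       vector [m1, m2 - m1 * k2, 1 - m1 * k3]]"
    by (simp add: U_def M_def V_def vec_eq_iff matrix_matrix_mult_def sum_3 forall_3)
  have swap: "(\<chi> i. if i = 1 then ?A $ i else mat 1 $ i) = N"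
             "(\<chi> i. if i = 1 then mat 1 $ i else ?A $ i) = V"
    by (simp_all add: N_def V_def char_matrix_def mat_def vec_eq_iff forall_3)
  have B: "?B = (if k3 * m1 = 2 then \<chi> i. if i = 3 then - V2 $ i else V2 $ i else V2)"
    using assms
    by (auto intro!: char_matrix_eqI[symmetric] simp: V2_def U mult.commute)
  have "modification (lin_action ?A) (weight_action N V)"
    using modification_swap[of "mat 1" ?A 1] by (simp add: lin_action_eq_weight_action swap)
  moreover have "modification (weight_action N V) (lin_action U)"
    using modification_reparametrize[OF MN NM, of N V]
    by (simp add: lin_action_eq_weight_action NM U_def)
  moreover have "modification\<^sup>*\<^sup>* (lin_action U) (lin_action V2)"
    unfolding V2_def lin_action_eq_weight_action by (auto intro: modification_conj_second)
  moreover have "modification\<^sup>*\<^sup>* (lin_action V2) (lin_action ?B)"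
    unfolding B lin_action_eq_weight_action by (auto intro: modification_conj_second)
  ultimately show ?thesis
    unfolding equivalent_matrices_def
    by (meson converse_rtranclp_into_rtranclp rtranclp_trans)
qed

section \<open>Matrices equivalent to a listed one\<close>

definition on_list :: "int^3^3 \<Rightarrow> bool" where
  "on_list B \<longleftrightarrow> (\<exists>p q. B = family_R p q) \<or> (\<exists>p q. B = family_S p q) \<or>
     (\<exists>p q r. B = family_T p q r) \<or> B \<in> {sporadic_1, sporadic_2, sporadic_3, sporadic_4}"

text \<open>
  Stated on the six off-diagonal entries, so that case distinctions and sign choices become
  substitutions of integers.
\<close>

definition classified :: "int \<Rightarrow> int \<Rightarrow> int \<Rightarrow> int \<Rightarrow> int \<Rightarrow> int \<Rightarrow> bool" where
  "classified k2 k3 l1 l3 m1 m2 \<longleftrightarrow>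
     (\<exists>B. equivalent_matrices (char_matrix k2 k3 l1 l3 m1 m2) B \<and> on_list B)"

lemma classified_on_list: "on_list (char_matrix k2 k3 l1 l3 m1 m2) \<Longrightarrow> classified k2 k3 l1 l3 m1 m2"
  by (auto simp: classified_def equivalent_matrices_def)

lemma classified_step:
  assumes "equivalent_matrices (char_matrix k2 k3 l1 l3 m1 m2) (char_matrix k2' k3' l1' l3' m1' m2')"
    and "classified k2' k3' l1' l3' m1' m2'"
  shows "classified k2 k3 l1 l3 m1 m2"
  using assms unfolding classified_def equivalent_matrices_def by (meson rtranclp_trans)

lemma classified_transpose_12:
  assumes "classified l1 l3 k2 k3 m2 m1"
  shows "classified k2 k3 l1 l3 m1 m2"
proof (rule classified_step[OF _ assms])
  let ?A = "char_matrix k2 k3 l1 l3 m1 m2" and ?t = "Transposition.transpose 1 2 :: 3 \<Rightarrow> 3"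
  have "(\<chi> i j. ?A $ ?t i $ ?t j) = char_matrix l1 l3 k2 k3 m2 m1"
    by (rule char_matrix_eqI) (simp_all add: char_matrix_def transpose_def)
  then show "equivalent_matrices ?A (char_matrix l1 l3 k2 k3 m2 m1)"
    using equivalent_matrices_permute[of ?t ?A] by simp
qed

lemma classified_transpose_23:
  assumes "classified k3 k2 m1 m2 l1 l3"
  shows "classified k2 k3 l1 l3 m1 m2"
proof (rule classified_step[OF _ assms])
  let ?A = "char_matrix k2 k3 l1 l3 m1 m2" and ?t = "Transposition.transpose 2 3 :: 3 \<Rightarrow> 3"
  have "(\<chi> i j. ?A $ ?t i $ ?t j) = char_matrix k3 k2 m1 m2 l1 l3"
    by (rule char_matrix_eqI) (simp_all add: char_matrix_def transpose_def)
  then show "equivalent_matrices ?A (char_matrix k3 k2 m1 m2 l1 l3)"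
    using equivalent_matrices_permute[of ?t ?A] by simp
qed

lemmas classified_transpose_13 =
  classified_transpose_12[OF classified_transpose_23[OF classified_transpose_12]]
lemmas classified_cycle = classified_transpose_12[OF classified_transpose_23]
lemmas classified_cycle_inv = classified_transpose_23[OF classified_transpose_12]

lemma classified_negate_2:
  assumes "classified (- k2) k3 (- l1) (- l3) m1 (- m2)"
  shows "classified k2 k3 l1 l3 m1 m2"
proof (rule classified_step[OF _ assms])
  let ?A = "char_matrix k2 k3 l1 l3 m1 m2"
  have "(\<chi> i j. if (i = 2) \<noteq> (j = 2) then - ?A $ i $ j else ?A $ i $ j) =
        char_matrix (- k2) k3 (- l1) (- l3) m1 (- m2)"
    by (rule char_matrix_eqI) (simp_all add: char_matrix_def)
  then show "equivalent_matrices ?A (char_matrix (- k2) k3 (- l1) (- l3) m1 (- m2))"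
    using equivalent_matrices_negate_row_col[of ?A 2] by simp
qed

lemma classified_negate_3:
  assumes "classified k2 (- k3) l1 (- l3) (- m1) (- m2)"
  shows "classified k2 k3 l1 l3 m1 m2"
  by (rule classified_transpose_23, rule classified_negate_2, rule classified_transpose_23, rule assms)

lemma classified_pivot:
  assumes "k2 * l1 \<in> {0, 2}" "k3 * m1 \<in> {0, 2}"
    and "classified (- k2) (- k3)
           ((1 - k2 * l1) * l1) ((1 - k2 * l1) * (l3 - l1 * k3))
           ((1 - k3 * m1) * m1) ((1 - k3 * m1) * (m2 - m1 * k2))"
  shows "classified k2 k3 l1 l3 m1 m2"
  using classified_step[OF equivalent_matrices_pivot] assms by blast

section \<open>Case distinction by the products along 2-cycles\<close>

lemma mult_eq_2_int:
  fixes x y :: int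
  assumes "x * y = 2"
  shows "(x, y) \<in> {(1, 2), (2, 1), (- 1, - 2), (- 2, - 1)}"
proof -
  have "\<bar>x\<bar> \<le> 2"
    using dvd_imp_le_int[of 2 x] dvd_triv_left[of x y] assms by simp
  then have "x \<in> {-2, -1, 0, 1, 2}" by auto
  then show ?thesis using assms by auto
qed

lemmas on_list_simps = on_list_def family_R_def family_S_def family_T_def
  sporadic_1_def sporadic_2_def sporadic_3_def sporadic_4_def char_matrix_def

lemma classified_sporadic:
  "classified 2 2 1 2 1 1" "classified 2 0 1 2 1 1" "classified 2 0 1 1 2 2" "classified 2 2 1 2 1 0"
  by (rule classified_on_list, simp add: on_list_simps)+

lemma classified_R_positive: "classified 2 0 1 0 m1 m2"
  by (rule classified_on_list, unfold on_list_simps, blast)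

lemma classified_S_positive: "classified 2 k3 1 l3 0 0"
  by (rule classified_on_list, unfold on_list_simps, blast)

lemma classified_T: "classified 0 0 l1 0 m1 m2"
  by (rule classified_on_list, unfold on_list_simps, blast)

lemma classified_R:
  assumes "k2 * l1 = 2"
  shows "classified k2 0 l1 0 m1 m2"
proof -
  have pos: "classified 2 0 1 0 m1 m2" "classified 1 0 2 0 m1 m2" for m1 m2
    by (rule classified_R_positive classified_transpose_12[OF classified_R_positive])+
  show ?thesis
    using mult_eq_2_int[OF assms] pos
      classified_negate_2[of "- 2" 0 "- 1" 0 m1 m2] classified_negate_2[of "- 1" 0 "- 2" 0 m1 m2]
    by auto
qed

lemma classified_S:
  assumes "k2 * l1 = 2"
  shows "classified k2 k3 l1 l3 0 0"
proof -
  have pos: "classified 2 k3 1 l3 0 0" "classified 1 k3 2 l3 0 0" for k3 l3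
    by (rule classified_S_positive classified_transpose_12[OF classified_S_positive])+
  show ?thesis
    using mult_eq_2_int[OF assms] pos
      classified_negate_2[of "- 2" k3 "- 1" l3 0 0] classified_negate_2[of "- 1" k3 "- 2" l3 0 0]
    by auto
qed

text \<open>
  Negating the second or third row and column makes both entries \<open>k2\<close> and \<open>k3\<close> positive. The products
  along cycles do not change, hence neither does any hypothesis \<open>H\<close> on them.
\<close>

lemma classified_wlog_positive_row:
  assumes "\<And>k2 k3 l1 l3 m1 m2. k2 > 0 \<Longrightarrow> k3 > 0 \<Longrightarrow>
       H (k2 * l1) (k3 * m1) (l3 * m2) (k2 * l3 * m1) (k3 * l1 * m2) \<Longrightarrow>
       classified k2 k3 l1 l3 m1 m2"
    and "k2 \<noteq> 0" "k3 \<noteq> 0" "H (k2 * l1) (k3 * m1) (l3 * m2) (k2 * l3 * m1) (k3 * l1 * m2)"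
  shows "classified k2 k3 l1 l3 m1 m2"
proof -
  have k3: "classified k2 k3 l1 l3 m1 m2"
    if "k2 > 0" "k3 \<noteq> 0" "H (k2 * l1) (k3 * m1) (l3 * m2) (k2 * l3 * m1) (k3 * l1 * m2)"
    for k2 k3 l1 l3 m1 m2
    using that assms(1)[of k2 k3 l1 m1 l3 m2] 
      classified_negate_3[OF assms(1)[of k2 "- k3" l1 "- m1" "- l3" "- m2"]]
    by (cases "k3 > 0") auto
  show ?thesis
    using assms(2-4) k3[of k2 k3 l1 m1 l3 m2]
      classified_negate_2[OF k3[of "- k2" k3 "- l1" m1 "- l3" "- m2"]]
    by (cases "k2 > 0") auto
qed

text \<open>
  The cycle products satisfy \<open>p * q = 8\<close> and \<open>p + q > 0\<close>, so all entries are positive once the first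
  row is. Then every entry is 1 or 2, and the constraint on \<open>p + q\<close> leaves six of the eight matrices:
  the orbit of \<open>A\<^sub>1\<close> under the symmetric group.
\<close>

lemma classified_three_twos:
  assumes "k2 * l1 = 2" "k3 * m1 = 2" "l3 * m2 = 2"
    and "k2 * l3 * m1 + k3 * l1 * m2 \<in> {4, 6}"
  shows "classified k2 k3 l1 l3 m1 m2"
proof (rule classified_wlog_positive_row[where
      H = "\<lambda>a b c p q. a = 2 \<and> b = 2 \<and> c = 2 \<and> p + q \<in> {4, 6}"])
  fix k2 k3 l1 l3 m1 m2 :: int
  assume "k2 > 0" "k3 > 0"
    and "k2 * l1 = 2 \<and> k3 * m1 = 2 \<and> l3 * m2 = 2 \<and> k2 * l3 * m1 + k3 * l1 * m2 \<in> {4, 6}"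
  then have "(k2, l1) \<in> {(1, 2), (2, 1)}" "(k3, m1) \<in> {(1, 2), (2, 1)}"
    "(l3, m2) \<in> {(1, 2), (2, 1), (- 1, - 2), (- 2, - 1)}"
    "k2 * l3 * m1 + k3 * l1 * m2 \<in> {4, 6}"
    using mult_eq_2_int[of k2 l1] mult_eq_2_int[of k3 m1] mult_eq_2_int[of l3 m2] by auto
  then show "classified k2 k3 l1 l3 m1 m2"
    using classified_sporadic(1)
      classified_transpose_12[OF classified_sporadic(1)]
      classified_transpose_23[OF classified_sporadic(1)]
      classified_transpose_13[OF classified_sporadic(1)]
      classified_cycle[OF classified_sporadic(1)]
      classified_cycle_inv[OF classified_sporadic(1)]
    by auto
qed (use assms in auto)

text \<open>
  After the pivot the product along the third 2-cycle is \<open>a * b - p = 2\<close>, and the products along the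
  3-cycles are \<open>a * b - p = 2\<close> and \<open>a * b = 4\<close>.
\<close>

lemma classified_two_twos_three_cycle_2:
  assumes "k2 * l1 = 2" "k3 * m1 = 2" "k2 * l3 * m1 = 2"
  shows "classified k2 k3 l1 l3 m1 0"
proof (rule classified_pivot)
  show "classified (- k2) (- k3) ((1 - k2 * l1) * l1) ((1 - k2 * l1) * (l3 - l1 * k3))
     ((1 - k3 * m1) * m1) ((1 - k3 * m1) * (0 - m1 * k2))"
  proof (rule classified_three_twos)
    have "k2 * (k3 * (l1 * m1)) = (k2 * l1) * (k3 * m1)" by (simp add: mult_ac)
    then have e: "k2 * (k3 * (l1 * m1)) = 4" using assms by simp
    show "(1 - k2 * l1) * (l3 - l1 * k3) * ((1 - k3 * m1) * (0 - m1 * k2)) = 2"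
      using assms e by (simp add: algebra_simps)
    show "- k2 * ((1 - k2 * l1) * (l3 - l1 * k3)) * ((1 - k3 * m1) * m1) +
      - k3 * ((1 - k2 * l1) * l1) * ((1 - k3 * m1) * (0 - m1 * k2)) \<in> {4, 6}"
      using assms e by (simp add: algebra_simps)
  qed (use assms in auto)
qed (use assms in auto)

text \<open>
  With a positive first row, \<open>k2\<close> and \<open>k3\<close> range over 1 and 2, and the remaining entries are determined
  by them. Three of the four matrices are sporadic up to a cyclic permutation; the one with
  \<open>l3 = 4\<close> reaches \<open>A\<^sub>2\<close> by a pivot.
\<close>

lemma classified_two_twos_three_cycle_4:
  assumes "k2 * l1 = 2" "k3 * m1 = 2" "k2 * l3 * m1 = 4"
  shows "classified k2 k3 l1 l3 m1 0"
proof (rule classified_wlog_positive_row[where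
      H = "\<lambda>a b c p q. a = 2 \<and> b = 2 \<and> c = 0 \<and> p = 4"])
  fix k2 k3 l1 l3 m1 m2 :: int
  assume "k2 > 0" "k3 > 0"
    and *: "k2 * l1 = 2 \<and> k3 * m1 = 2 \<and> l3 * m2 = 0 \<and> k2 * l3 * m1 = 4"
  then have "(k2, l1) \<in> {(1, 2), (2, 1)}" "(k3, m1) \<in> {(1, 2), (2, 1)}"
    using mult_eq_2_int[of k2 l1] mult_eq_2_int[of k3 m1] by auto
  moreover have "m2 = 0" using * by auto
  moreover have "classified 2 1 1 1 2 0"
    by (rule classified_cycle_inv classified_cycle, rule classified_sporadic)
  moreover have "classified 1 1 2 2 2 0"
    by (rule classified_cycle_inv classified_cycle, rule classified_sporadic)
  \<comment> \<open>The two negations cancel the sign which the pivot puts on the first row.\<close>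
  moreover have "classified 1 2 2 4 1 0"
    by (rule classified_negate_2, rule classified_negate_3, rule classified_pivot, simp, simp, simp)
       (rule classified_transpose_12, rule classified_sporadic)
  ultimately show "classified k2 k3 l1 l3 m1 m2"
    using * classified_sporadic by auto
qed (use assms in auto)

lemma classified_two_twos:
  assumes "k2 * l1 = 2" "k3 * m1 = 2" "l3 * m2 = 0"
    and "k2 * l3 * m1 + k3 * l1 * m2 \<in> {2, 4}"
  shows "classified k2 k3 l1 l3 m1 m2"
proof (cases "m2 = 0")
  case True
  then show ?thesis
    using assms classified_two_twos_three_cycle_2[of k2 l1 k3 m1 l3] classified_two_twos_three_cycle_4[of k2 l1 k3 m1 l3]
    by auto
next
  case False
  then show ?thesis
    using assms classified_two_twos_three_cycle_2[of k3 m1 k2 l1 m2] classified_two_twos_three_cycle_4[of k3 m1 k2 l1 m2]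
    by - (rule classified_transpose_23, auto simp: mult_ac)
qed

text \<open>
  The pivot keeps \<open>a = 2\<close> and \<open>b = 0\<close>. It creates the entry \<open>- m1 * k2\<close> opposite to \<open>- l3\<close>, so that
  \<open>c = k2 * l3 * m1 = 2\<close>, while the 3-cycle keeps its product 2.
\<close>

lemma classified_one_two_cycle:
  assumes "k2 * l1 = 2" "k2 * l3 * m1 = 2"
  shows "classified k2 0 l1 l3 m1 0"
proof (rule classified_pivot)
  show "classified (- k2) (- 0) ((1 - k2 * l1) * l1) ((1 - k2 * l1) * (l3 - l1 * 0))
     ((1 - 0 * m1) * m1) ((1 - 0 * m1) * (0 - m1 * k2))"
    using assms
    by (intro classified_transpose_12[OF classified_two_twos]) (auto simp: algebra_simps)
qed (use assms in auto)

text \<open>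
  Each of \<open>b = 0\<close> and \<open>c = 0\<close> makes an entry in the third row or column vanish. If the third row
  or column vanishes off the diagonal, the matrix is in the family \<open>S\<close> or \<open>R\<close> up to permutation
  and sign. Otherwise the zeros break one of the 3-cycles, and the other one has a nonzero product,
  which the determinant forces to be 2.
\<close>

lemma classified_one_two:
  assumes "k2 * l1 = 2" "k3 * m1 = 0" "l3 * m2 = 0"
    and "k2 * l3 * m1 + k3 * l1 * m2 \<in> {0, 2}"
  shows "classified k2 k3 l1 l3 m1 m2"
proof -
  have nz: "k2 \<noteq> 0" "l1 \<noteq> 0" using assms(1) by auto
  consider "k3 = 0" "l3 = 0" | "m1 = 0" "m2 = 0" | "k3 = 0" "m2 = 0" "k2 * l3 * m1 = 2"
    | "m1 = 0" "l3 = 0" "l1 * k3 * m2 = 2"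
    using assms nz by (auto simp: mult_ac)
  then show ?thesis
  proof cases
    case 4
    then show ?thesis
      using assms(1)
      by (auto intro!: classified_transpose_12[OF classified_one_two_cycle] simp: mult.commute)
  qed (use assms(1) in \<open>auto intro: classified_R classified_S classified_one_two_cycle\<close>)
qed

text \<open>
  The pivot creates the entry \<open>- m1 * k2\<close> opposite to \<open>l3\<close>. This makes \<open>c = - (k2 * l3 * m1) = 2\<close>, and
  the 3-cycle now has product 2.
\<close>

lemma classified_zero_twos_cycle:
  assumes "k2 * l3 * m1 = - 2"
  shows "classified k2 0 0 l3 m1 0"
proof (rule classified_pivot)
  show "classified (- k2) (- 0) ((1 - k2 * 0) * 0) ((1 - k2 * 0) * (l3 - 0 * 0))
     ((1 - 0 * m1) * m1) ((1 - 0 * m1) * (0 - m1 * k2))"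
    using assms
    by (intro classified_transpose_13[OF classified_one_two]) (auto simp: algebra_simps)
qed auto

text \<open>
  Without a nonzero cycle the vertices can be ordered so that the matrix is lower triangular; the six
  zero patterns in the third case are the six orders.
\<close>

lemma classified_zero_twos:
  assumes "k2 * l1 = 0" "k3 * m1 = 0" "l3 * m2 = 0"
    and "k2 * l3 * m1 + k3 * l1 * m2 \<in> {0, - 2}"
  shows "classified k2 k3 l1 l3 m1 m2"
proof -
  consider "l1 = 0" "k3 = 0" "m2 = 0" "k2 * l3 * m1 = -2"
    | "k2 = 0" "m1 = 0" "l3 = 0" "k3 * m2 * l1 = -2"
    | "k2 = 0 \<and> k3 = 0 \<and> l3 = 0 \<or> k2 = 0 \<and> k3 = 0 \<and> m2 = 0 \<or> l1 = 0 \<and> l3 = 0 \<and> k3 = 0 \<or>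
       l1 = 0 \<and> l3 = 0 \<and> m1 = 0 \<or> m1 = 0 \<and> m2 = 0 \<and> k2 = 0 \<or> m1 = 0 \<and> m2 = 0 \<and> l1 = 0"
    using assms by (auto simp: mult_ac)
  then show ?thesis
  proof cases
    case 1
    then show ?thesis by (auto intro: classified_zero_twos_cycle)
  next
    case 2
    then show ?thesis
      by (auto intro: classified_transpose_23[OF classified_zero_twos_cycle])
  next
    case 3
    then show ?thesis
      using classified_T classified_transpose_12[OF classified_T]
        classified_transpose_23[OF classified_T] classified_transpose_13[OF classified_T]
        classified_cycle[OF classified_T] classified_cycle_inv[OF classified_T]
      by auto
  qed
qed

lemma classified_of_minors:
  assumes abc: "k2 * l1 \<in> {0, 2}" "k3 * m1 \<in> {0, 2}" "l3 * m2 \<in> {0, 2}"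
    and det: "1 - k2 * l1 - k3 * m1 - l3 * m2 + k2 * l3 * m1 + k3 * l1 * m2 \<in> {1, - 1}"
  shows "classified k2 k3 l1 l3 m1 m2"
proof -
  consider "k2 * l1 = 2" "k3 * m1 = 2" "l3 * m2 = 2"
    | "k2 * l1 = 2" "k3 * m1 = 2" "l3 * m2 = 0"
    | "k2 * l1 = 2" "k3 * m1 = 0" "l3 * m2 = 2"
    | "k2 * l1 = 0" "k3 * m1 = 2" "l3 * m2 = 2"
    | "k2 * l1 = 2" "k3 * m1 = 0" "l3 * m2 = 0"
    | "k2 * l1 = 0" "k3 * m1 = 2" "l3 * m2 = 0"
    | "k2 * l1 = 0" "k3 * m1 = 0" "l3 * m2 = 2"
    | "k2 * l1 = 0" "k3 * m1 = 0" "l3 * m2 = 0"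
    using abc by auto
  then show ?thesis
  proof cases
    case 1
    then show ?thesis using det by (intro classified_three_twos) auto
  next
    case 2
    then show ?thesis using det by (intro classified_two_twos) auto
  next
    case 3
    then show ?thesis using det
      by (intro classified_transpose_12[OF classified_two_twos]) (auto simp: algebra_simps)
  next
    case 4
    then show ?thesis using det
      by (intro classified_transpose_13[OF classified_two_twos]) (auto simp: algebra_simps)
  next
    case 5
    then show ?thesis using det by (intro classified_one_two) auto
  next
    case 6
    then show ?thesis using det
      by (intro classified_transpose_23[OF classified_one_two]) (auto simp: algebra_simps)
  next
    case 7
    then show ?thesis using det
      by (intro classified_transpose_13[OF classified_one_two]) (auto simp: algebra_simps)
  next
    case 8
    then show ?thesis using det by (intro classified_zero_twos) auto
  qed
qed

theorem proposition4p23: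
  fixes k2 k3 l1 l3 m1 m2 :: int and A :: "int^3^3"
  assumes A: "A = char_matrix k2 k3 l1 l3 m1 m2"
    and free: "acts_freely (lin_action A)"
    and det_A: "det A \<in> {1, -1}"
    and cofactor_1: "det (vector [vector [1, l3], vector [m2, 1]] :: int^2^2) \<in> {1, -1}"
    and cofactor_2: "det (vector [vector [1, k3], vector [m1, 1]] :: int^2^2) \<in> {1, -1}"
    and cofactor_3: "det (vector [vector [1, k2], vector [l1, 1]] :: int^2^2) \<in> {1, -1}"
  shows "\<exists>B. equivalent_matrices A B \<and>
    ((\<exists>p q. B = family_R p q) \<or>
     (\<exists>p q. B = family_S p q) \<or>
     (\<exists>p q r. B = family_T p q r) \<or>
     B \<in> {sporadic_1, sporadic_2, sporadic_3, sporadic_4})"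
proof -
  have "classified k2 k3 l1 l3 m1 m2"
  proof (rule classified_of_minors)
    show "k2 * l1 \<in> {0, 2}" "k3 * m1 \<in> {0, 2}" "l3 * m2 \<in> {0, 2}"
      using cofactor_1 cofactor_2 cofactor_3 by (auto simp: det_2)
    show "1 - k2 * l1 - k3 * m1 - l3 * m2 + k2 * l3 * m1 + k3 * l1 * m2 \<in> {1, - 1}"
      using det_A by (auto simp: A char_matrix_def det_3 algebra_simps)
  qed
  then show ?thesis
    by (simp add: classified_def on_list_def A)
qed

end
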